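(* Let $R$ be a commutative integral domain whose quotient field has characteristic zero, let $\alpha$ be an umbra (over $R$), let $n\ge 1$, let $\alpha_1,\dots,\alpha_n$ be $n$ uncorrelated umbrae similar to $\alpha$, and let $V_n$ be the $n$-volume polynomial. Then $$n!\,V_n(\alpha_1,\ldots,\alpha_n)\;\simeq\; A_n(\alpha,-1\boldsymbol{.}\alpha)\;\simeq\;\alpha(\alpha+n\boldsymbol{.}\alpha)^{n-1},$$ where $A_n(x,\gamma)=x(x-n\boldsymbol{.}\gamma)^{n-1}$ is the Abel polynomial.
   Context: **Volume polynomial.** A parking function of length $n$ is a sequence $\mathbf p=(p_1,\dots,p_n)$ of positive integers whose nondecreasing rearrangement $(p'_1,\dots,p'_n)$ satisfies $p'_j\le j$ for all $j$; $park(n)$ is the set of these. The $n$-volume polynomial in commuting variables $y_1,\dots,y_n$ is $V_n(y_1,\dots,y_n)=\frac1{n!}\sum_{\mathbf p\in park(n)}y_{p_1}y_{p_2}\cdots y_{p_n}$. **Umbral calculus.** One has an alphabet $A$ of symbols (umbrae) and an $R$-linear functional $E:R[A]\to R$ with $E[1]=1$ and $E[\alpha^i\gamma^j\cdots\delta^k]=E[\alpha^i]E[\gamma^j]\cdots E[\delta^k]$ for pairwise distinct umbrae (distinct umbrae are "uncorrelated"). The $i$-th moment of $\alpha$ is $E[\alpha^i]$. For polynomials $p,q$ in umbrae, $p\simeq q$ (umbral equivalence) means $E[p]=E[q]$, and $p\equiv q$ (similarity) means $E[p^i]=E[q^i]$ for all $i\ge 0$. The generating function of $\alpha$ is $f(\alpha,t)=\sum_{i\ge0}E[\alpha^i]\,t^i/i!$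 (over the quotient field of $R$); $\alpha\equiv\gamma$ iff $f(\alpha,t)=f(\gamma,t)$. The umbral calculus is saturated: the alphabet is enlarged by auxiliary umbrae, to which $E$ is extended with the same uncorrelation property, and as many uncorrelated copies of any umbra as needed are available. **Dot operation.** For an umbra $\alpha$ and an integer $m$, $m\boldsymbol{.}\alpha$ is an auxiliary umbra with $f(m\boldsymbol{.}\alpha,t)=f(\alpha,t)^m$; for $m\ge1$ it is similar to a sum of $m$ uncorrelated umbrae similar to $\alpha$, and $-1\boldsymbol{.}\alpha$ is determined up to similarity by $E[(\alpha+(-1\boldsymbol{.}\alpha))^i]=0$ for all $i\ge1$. An auxiliary umbra $m\boldsymbol{.}\alpha$ is uncorrelated with $\alpha$. In the Abel polynomial, $x-n\boldsymbol{.}\gamma$ means $x+(-n)\boldsymbol{.}\gamma$, where $(-n)\boldsymbol{.}\gamma$ has generating function $f(\gamma,t)^{-n}$. *)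

theory Defs
  imports
    "HOL-Library.Poly_Mapping"
    "HOL-Computational_Algebra.Computational_Algebra"
begin

text \<open>Polynomials over \<open>'r\<close> in commuting variables from \<open>'v\<close>: a finitely supported function
  from exponent vectors to coefficients. Multiplication of \<^type>\<open>poly_mapping\<close> is convolution.\<close>

type_synonym ('v, 'r) mvpoly = "('v \<Rightarrow>\<^sub>0 nat) \<Rightarrow>\<^sub>0 'r"

definition Const :: "'r \<Rightarrow> ('v, 'r::comm_ring_1) mvpoly" where
  "Const c = Poly_Mapping.single 0 c"

definition Var :: "'v \<Rightarrow> ('v, 'r::comm_ring_1) mvpoly" where
  "Var v = Poly_Mapping.single (Poly_Mapping.single v 1) 1"

text \<open>The inclusion of \<open>R[A]\<close> in \<open>K[A]\<close>, where \<open>K\<close> is the quotient field of \<open>R\<close>.\<close>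

definition embed_mvpoly :: "('v, 'r::idom) mvpoly \<Rightarrow> ('v, 'r fract) mvpoly" where
  "embed_mvpoly p = Poly_Mapping.map to_fract p"


definition park :: "nat \<Rightarrow> nat list set" where
  "park n = {p. length p = n \<and> (\<forall>x\<in>set p. 1 \<le> x) \<and> (\<forall>j\<in>{1..n}. sort p ! (j - 1) \<le> j)}"

text \<open>The volume polynomial with the polynomials \<open>y 1, \<dots>, y n\<close> substituted for its variables;
  \<open>y = Var\<close> gives the volume polynomial itself. Since \<^const>\<open>fact\<close> is confined to a type class of
  characteristic zero, which \<^typ>\<open>'r fract\<close> does not belong to, the factorial is taken in the
  naturals here and below.\<close>

definition volume_poly :: "nat \<Rightarrow> (nat \<Rightarrow> ('v, 'k::field) mvpoly) \<Rightarrow> ('v, 'k) mvpoly" where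
  "volume_poly n y = Const (1 / of_nat (fact n)) * (\<Sum>p\<in>park n. prod_list (map y p))"


text \<open>The saturated alphabet over a basic alphabet \<open>'a\<close>. \<open>Dot m \<alpha>\<close> is the auxiliary umbra obtained
  from \<open>\<alpha>\<close> by the dot operation; as a new symbol it differs from, and hence is uncorrelated with,
  every umbra it is built from. No constructor for copies is needed: \<open>Dot 1 \<alpha>\<close>,
  \<open>Dot 1 (Dot 1 \<alpha>)\<close>, \<open>\<dots>\<close> are pairwise distinct umbrae similar to \<open>\<alpha>\<close>.\<close>

datatype 'a umbra = Letter 'a | Dot int "'a umbra"

type_synonym ('a, 'r) umbral_poly = "('a umbra, 'r) mvpoly"

definition gen_fun :: "(('a, 'r::idom) umbral_poly \<Rightarrow> 'r) \<Rightarrow> 'a umbra \<Rightarrow> 'r fract fps" where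
  "gen_fun E \<alpha> = Abs_fps (\<lambda>i. to_fract (E (Var \<alpha> ^ i)) / of_nat (fact i))"

locale umbral_calculus =
  fixes E :: "('a, 'r::idom) umbral_poly \<Rightarrow> 'r"
  assumes E_add: "E (p + q) = E p + E q"
    and E_scale: "E (Const c * p) = c * E p"
    and E_one: "E 1 = 1"
    and E_uncorrelated:
      "finite S \<Longrightarrow> E (\<Prod>\<alpha>\<in>S. Var \<alpha> ^ e \<alpha>) = (\<Prod>\<alpha>\<in>S. E (Var \<alpha> ^ e \<alpha>))"
    and gen_fun_Dot: "gen_fun E (Dot m \<alpha>) = gen_fun E \<alpha> powi m"

definition umbral_equiv ::
    "(('a, 'r::idom) umbral_poly \<Rightarrow> 'r) \<Rightarrow> ('a, 'r) umbral_poly \<Rightarrow> ('a, 'r) umbral_poly \<Rightarrow> bool" where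
  "umbral_equiv E p q \<longleftrightarrow> E p = E q"

definition similar ::
    "(('a, 'r::idom) umbral_poly \<Rightarrow> 'r) \<Rightarrow> ('a, 'r) umbral_poly \<Rightarrow> ('a, 'r) umbral_poly \<Rightarrow> bool" where
  "similar E p q \<longleftrightarrow> (\<forall>i. E (p ^ i) = E (q ^ i))"

text \<open>The subtrahend in \<open>x - n.\<gamma>\<close> is not \<open>Var (Dot n \<gamma>)\<close>: the difference stands for
  \<open>x + (-n).\<gamma>\<close>, and \<open>(-n).\<gamma>\<close> is not similar to the negative of \<open>n.\<gamma>\<close>.\<close>

definition abel_poly :: "nat \<Rightarrow> ('a, 'r::comm_ring_1) umbral_poly \<Rightarrow> 'a umbra \<Rightarrow> ('a, 'r) umbral_poly" where
  "abel_poly n x \<gamma> = x * (x + Var (Dot (- int n) \<gamma>)) ^ (n - 1)"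

end

theory Submission
  imports Defs
begin

text \<open>Pollak's circle argument: among the \<open>n + 1\<close> rotations modulo \<open>n + 1\<close> of a word of length \<open>n\<close>
  in \<open>n + 1\<close> letters exactly one is a parking function, and rotations preserve the product of the
  moments indexed by the letter counts. Hence the evaluation of \<open>n! V\<^sub>n\<close> is
  \<open>1 / (n + 1)\<close> times the sum over all words, which is \<open>n! [t\<^sup>n] f\<^sup>n\<^sup>+\<^sup>1\<close> for the generating
  function \<open>f\<close> of \<open>\<alpha>\<close>. Differentiating \<open>f\<^sup>n\<^sup>+\<^sup>1\<close> turns this into \<open>(n - 1)! [t\<^sup>n\<^sup>-\<^sup>1] f' f\<^sup>n\<close>,
  which is what the binomial theorem gives for \<open>\<alpha> (\<alpha> + n.\<alpha>)\<^sup>n\<^sup>-\<^sup>1\<close>; moreover \<open>(-n).(-1.\<alpha>)\<close>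
  has the same generating function \<open>f\<^sup>n\<close> as \<open>n.\<alpha>\<close>.\<close>

section \<open>Rotations modulo \<open>n + 1\<close> and first minima\<close>

text \<open>Adding \<open>Suc n - k\<close> subtracts \<open>k\<close> modulo \<open>Suc n\<close>
  without truncation, so adding \<open>k\<close> undoes it.\<close>

lemma rotation_bij:
  fixes k n :: nat
  assumes "k \<le> n"
  shows "bij_betw (\<lambda>x. (x + (Suc n - k)) mod Suc n) {..n} {..n}"
proof (rule bij_betw_byWitness[where f' = "\<lambda>x. (x + k) mod Suc n"])
  show "\<forall>x\<in>{..n}. ((x + (Suc n - k)) mod Suc n + k) mod Suc n = x"
  proof
    fix x assume "x \<in> {..n}"
    have "((x + (Suc n - k)) mod Suc n + k) mod Suc n = (x + (Suc n - k) + k) mod Suc n"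
      by (rule mod_add_left_eq)
    also have "x + (Suc n - k) + k = x + Suc n" using assms by simp
    finally show "((x + (Suc n - k)) mod Suc n + k) mod Suc n = x"
      using \<open>x \<in> {..n}\<close> by (simp only: mod_add_self2) simp
  qed
  show "\<forall>x\<in>{..n}. ((x + k) mod Suc n + (Suc n - k)) mod Suc n = x"
  proof
    fix x assume "x \<in> {..n}"
    have "((x + k) mod Suc n + (Suc n - k)) mod Suc n = (x + k + (Suc n - k)) mod Suc n"
      by (rule mod_add_left_eq)
    also have "x + k + (Suc n - k) = x + Suc n" using assms by simp
    finally show "((x + k) mod Suc n + (Suc n - k)) mod Suc n = x"
      using \<open>x \<in> {..n}\<close> by (simp only: mod_add_self2) simp
  qed
qed (auto intro: mod_Suc_le_divisor)

text \<open>The letters sent below \<open>j\<close> form the cyclic interval of length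
  \<open>j\<close> starting at \<open>k\<close>. The two branches tell whether it wraps around past
  \<open>n\<close>.\<close>

lemma rotation_less_iff:
  fixes j k n x :: nat
  assumes "k \<le> n" "x \<le> n" "j \<le> n"
  shows "(x + (Suc n - k)) mod Suc n < j \<longleftrightarrow>
    (if k + j \<le> Suc n then k \<le> x \<and> x < k + j else k \<le> x \<or> x < k + j - Suc n)"
proof (cases "k \<le> x")
  case True
  then have "(x + (Suc n - k)) mod Suc n = x - k"
    using assms by (simp add: mod_if)
  then show ?thesis using assms True by auto
next
  case False
  then have "(x + (Suc n - k)) mod Suc n = x + (Suc n - k)"
    using assms by (simp add: mod_if)
  then show ?thesis using assms False by auto
qed

lemma length_filter_between:
  fixes k l :: "'a::linorder"
  assumes "k \<le> l"
  shows "length (filter (\<lambda>x. k \<le> x \<and> x < l) w) + length (filter (\<lambda>x. x < k) w) =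
    length (filter (\<lambda>x. x < l) w)"
  using assms by (induction w) auto

lemma length_filter_outside:
  fixes k l :: "'a::linorder"
  assumes "l \<le> k"
  shows "length (filter (\<lambda>x. k \<le> x \<or> x < l) w) + length (filter (\<lambda>x. x < k) w) =
    length w + length (filter (\<lambda>x. x < l) w)"
  using assms by (induction w) auto

text \<open>Weak inequalities to the right and strict ones to the left single out the leftmost
  minimiser, which is what makes \<open>k\<close> unique when values are tied.\<close>

lemma ex1_first_minimum:
  fixes S :: "nat \<Rightarrow> 'b::linorder"
  shows "\<exists>!k. k \<le> n \<and> (\<forall>l. k < l \<and> l \<le> n \<longrightarrow> S k \<le> S l) \<and> (\<forall>l<k. S k < S l)"
proof -
  define m where "m = Min (S ` {..n})"
  define k where "k = (LEAST k. k \<le> n \<and> S k = m)"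
  have "m \<in> S ` {..n}" unfolding m_def by (rule Min_in) auto
  then have ex: "\<exists>k. k \<le> n \<and> S k = m" by auto
  have k: "k \<le> n" "S k = m" using LeastI_ex[OF ex] by (auto simp: k_def)
  have min: "m \<le> S l" if "l \<le> n" for l using that by (auto simp: m_def)
  have first: "S k < S l" if "l < k" for l
  proof -
    have "S l \<noteq> m" using not_less_Least[of l "\<lambda>k. k \<le> n \<and> S k = m"] that k(1)
      by (auto simp: k_def[symmetric])
    then show ?thesis using min[of l] that k by auto
  qed
  show ?thesis
  proof (rule ex1I[of _ k])
    show "k \<le> n \<and> (\<forall>l. k < l \<and> l \<le> n \<longrightarrow> S k \<le> S l) \<and> (\<forall>l<k. S k < S l)"
      using k min first by auto
  next
    fix k' assume *: "k' \<le> n \<and> (\<forall>l. k' < l \<and> l \<le> n \<longrightarrow> S k' \<le> S l) \<and> (\<forall>l<k'. S k' < S l)"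
    show "k' = k"
    proof (cases k' k rule: linorder_cases)
      case less
      then have "S k' \<le> S k" using * k(1) by blast
      then show ?thesis using first[OF less] by simp
    next
      case greater
      then have "S k' < S k" using * by blast
      then show ?thesis using min[of k'] * k(2) by simp
    qed
  qed
qed

section \<open>Parking functions and the cycle lemma\<close>

text \<open>The letter \<open>n\<close> is the extra spot that closes the street to a
  circle.\<close>

definition words :: "nat \<Rightarrow> nat list set" where
  "words n = {w. set w \<subseteq> {..n} \<and> length w = n}"

lemma finite_words: "finite (words n)"
  unfolding words_def by (rule finite_lists_length_eq) simp

text \<open>Parking functions counted from \<open>0\<close>.\<close>

definition parks :: "nat list \<Rightarrow> bool" where
  "parks w \<longleftrightarrow> (\<forall>j\<in>{1..length w}. j \<le> length (filter (\<lambda>x. x < j) w))"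

text \<open>In a sorted list the entries at most \<open>b\<close> form a prefix, and the filter
  measures its length.\<close>

lemma sorted_nth_le_iff:
  fixes s :: "'a::linorder list"
  assumes "sorted s" "i < length s"
  shows "s ! i \<le> b \<longleftrightarrow> i < length (filter (\<lambda>x. x \<le> b) s)"
  using assms
proof (induction s arbitrary: i)
  case (Cons a s)
  show ?case
  proof (cases "a \<le> b")
    case True
    then show ?thesis using Cons by (cases i) auto
  next
    case False
    then have "filter (\<lambda>x. x \<le> b) (a # s) = []"
      using Cons.prems by (auto simp: filter_empty_conv)
    moreover have "a \<le> (a # s) ! i"
      using Cons.prems by (cases i) auto
    ultimately show ?thesis using False by auto
  qed
qed simp

text \<open>Sorting does not change how many entries lie below a bound, so the condition on the
  sorted list becomes one on counts.\<close>

lemma map_Suc_in_park_iff: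
  assumes "length w = n"
  shows "map Suc w \<in> park n \<longleftrightarrow> parks w"
proof -
  have "sort (map Suc w) ! (j - 1) \<le> j \<longleftrightarrow> j \<le> length (filter (\<lambda>x. x < j) w)"
    if "j \<in> {1..n}" for j
  proof -
    have "sort (map Suc w) ! (j - 1) \<le> j \<longleftrightarrow>
        j - 1 < length (filter (\<lambda>x. x \<le> j) (sort (map Suc w)))"
      using that assms by (intro sorted_nth_le_iff) auto
    also have "length (filter (\<lambda>x. x \<le> j) (sort (map Suc w))) = length (filter (\<lambda>x. x < j) w)"
      by (simp add: filter_sort filter_map o_def Suc_le_eq)
    finally show ?thesis using that by auto
  qed
  then show ?thesis using assms by (auto simp: park_def parks_def)
qed

lemma set_park:
  assumes "p \<in> park n"
  shows "set p \<subseteq> {1..n}"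
proof
  fix x assume x: "x \<in> set p"
  then obtain i where i: "i < n" "sort p ! i = x"
    using assms by (metis (mono_tags, lifting) in_set_conv_nth length_sort mem_Collect_eq park_def set_sort)
  then have "sort p ! (Suc i - 1) \<le> Suc i"
    using assms unfolding park_def by (metis (mono_tags, lifting) Suc_leI atLeastAtMost_iff le_add1 mem_Collect_eq plus_1_eq_Suc)
  then show "x \<in> {1..n}" using i x assms by (auto simp: park_def)
qed

lemma park_eq: "park n = map Suc ` {w \<in> words n. parks w}"
proof (intro equalityI subsetI)
  fix p assume p: "p \<in> park n"
  define w where "w = map (\<lambda>x. x - 1) p"
  have pw: "p = map Suc w" and len: "length w = n"
    using p by (auto simp: w_def park_def o_def intro!: map_idI[symmetric])
  have pk: "parks w" using p pw len map_Suc_in_park_iff by auto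
  have "set w \<subseteq> {..n}"
    using set_park[OF p] pw by auto
  then show "p \<in> map Suc ` {w \<in> words n. parks w}" using pw len pk by (auto simp: words_def)
next
  fix p assume "p \<in> map Suc ` {w \<in> words n. parks w}"
  then show "p \<in> park n" by (auto simp: words_def map_Suc_in_park_iff)
qed

text \<open>Here \<open>C l\<close> counts the letters of a word that are less than \<open>l\<close>, and \<open>D\<close> does the same for
  the word rotated by \<open>k\<close>. The good \<open>k\<close> is the first minimum of \<open>S\<close>.\<close>

lemma rotated_counts_iff:
  fixes C D :: "nat \<Rightarrow> nat"
  defines "S \<equiv> \<lambda>l. int (C l) - int l"
  assumes k: "k \<le> n" and C0: "C 0 = 0" and Cn: "C (Suc n) = n"
    and D1: "\<And>j. j \<le> n \<Longrightarrow> k + j \<le> Suc n \<Longrightarrow> D j + C k = C (k + j)"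
    and D2: "\<And>j. j \<le> n \<Longrightarrow> \<not> k + j \<le> Suc n \<Longrightarrow> D j + C k = n + C (k + j - Suc n)"
  shows "(\<forall>j\<in>{1..n}. j \<le> D j) \<longleftrightarrow>
    (\<forall>l. k < l \<and> l \<le> n \<longrightarrow> S k \<le> S l) \<and> (\<forall>l<k. S k < S l)"
proof (intro iffI conjI allI impI)
  assume *: "\<forall>j\<in>{1..n}. j \<le> D j"
  show "S k \<le> S l" if "k < l \<and> l \<le> n" for l
  proof -
    have "l - k \<le> D (l - k)" by (rule bspec[OF *]) (use that in auto)
    then show ?thesis using D1[of "l - k"] that unfolding S_def by simp linarith
  qed
  \<comment> \<open>A full turn gains \<open>n\<close> letters over \<open>n + 1\<close> positions,
    so \<open>S\<close> drops by one when the rotated interval passes \<open>n\<close>. Hence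
    \<open>j \<le> D j\<close> gives \<open>S k \<le> S l - 1\<close>. For \<open>l = 0\<close> the
    interval ends exactly at \<open>Suc n\<close> and \<open>D1\<close> still applies.\<close>
  show "S k < S l" if "l < k" for l
  proof (cases "l = 0")
    case True
    have "Suc n - k \<le> D (Suc n - k)" by (rule bspec[OF *]) (use that k in auto)
    then show ?thesis using D1[of "Suc n - k"] that k C0 Cn True by (simp add: S_def)
  next
    case False
    define j where "j = l + Suc n - k"
    have j: "j \<in> {1..n}" "k + j = l + Suc n" using False that k by (auto simp: j_def)
    then have "j \<le> D j" using * by auto
    then show ?thesis using D2[of j] j False by (simp add: S_def)
  qed
next
  assume *: "(\<forall>l. k < l \<and> l \<le> n \<longrightarrow> S k \<le> S l) \<and> (\<forall>l<k. S k < S l)"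
  show "\<forall>j\<in>{1..n}. j \<le> D j"
  proof
    fix j assume j: "j \<in> {1..n}"
    \<comment> \<open>The interval from \<open>k\<close> ends before the turn is complete, ends
      exactly with it (compare with \<open>S 0\<close>), or wraps around.\<close>
    consider "k + j \<le> n" | "k + j = Suc n" | "Suc n < k + j" by linarith
    then show "j \<le> D j"
    proof cases
      case 1
      then have "S k \<le> S (k + j)" using * j by auto
      then show ?thesis using D1[of j] 1 j by (simp add: S_def)
    next
      case 2
      then have "S k < S 0" using * j by auto
      then show ?thesis using D1[of j] 2 j C0 Cn by (simp add: S_def)
    next
      case 3
      then have "S k < S (k + j - Suc n)" using * j by auto
      then show ?thesis using D2[of j] 3 j by (simp add: S_def)
    qed
  qed
qed

text \<open>By \<open>rotation_less_iff\<close> each count for the rotated word counts letters in a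
  cyclic interval of the original one, hence is a difference of its cumulative counts, up to a full
  turn of \<open>n\<close> letters.\<close>

lemma parks_rotate_iff:
  fixes n w
  defines "S \<equiv> \<lambda>l. int (length (filter (\<lambda>x. x < l) w)) - int l"
  assumes w: "w \<in> words n" and k: "k \<le> n"
  shows "parks (map (\<lambda>x. (x + (Suc n - k)) mod Suc n) w) \<longleftrightarrow>
    (\<forall>l. k < l \<and> l \<le> n \<longrightarrow> S k \<le> S l) \<and> (\<forall>l<k. S k < S l)"
proof -
  let ?C = "\<lambda>l. length (filter (\<lambda>x. x < l) w)"
  let ?D = "\<lambda>j. length (filter (\<lambda>x. x < j) (map (\<lambda>x. (x + (Suc n - k)) mod Suc n) w))"
  have len: "length w = n" and le: "\<And>x. x \<in> set w \<Longrightarrow> x \<le> n" using w by (auto simp: words_def)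
  have D: "?D j = length (filter (\<lambda>x. (x + (Suc n - k)) mod Suc n < j) w)" for j
    by (simp add: filter_map o_def)
  have D1: "?D j + ?C k = ?C (k + j)" if "j \<le> n" "k + j \<le> Suc n" for j
  proof -
    have "?D j = length (filter (\<lambda>x. k \<le> x \<and> x < k + j) w)"
      unfolding D using that k le
      by (intro arg_cong[where f = length] filter_cong refl) (subst rotation_less_iff, auto)
    then show ?thesis using length_filter_between[of k "k + j" w] by simp
  qed
  have D2: "?D j + ?C k = n + ?C (k + j - Suc n)" if "j \<le> n" "\<not> k + j \<le> Suc n" for j
  proof -
    have "?D j = length (filter (\<lambda>x. k \<le> x \<or> x < k + j - Suc n) w)"
      unfolding D using that k le
      by (intro arg_cong[where f = length] filter_cong refl) (subst rotation_less_iff, auto)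
    then show ?thesis using length_filter_outside[of "k + j - Suc n" k w] that len by simp
  qed
  have Cn: "?C (Suc n) = n" using le len by (simp add: less_Suc_eq_le)
  have "parks (map (\<lambda>x. (x + (Suc n - k)) mod Suc n) w) \<longleftrightarrow> (\<forall>j\<in>{1..n}. j \<le> ?D j)"
    unfolding parks_def by (simp only: length_map len)
  also have "\<dots> \<longleftrightarrow> (\<forall>l. k < l \<and> l \<le> n \<longrightarrow> S k \<le> S l) \<and> (\<forall>l<k. S k < S l)"
    unfolding S_def by (rule rotated_counts_iff[OF k _ Cn D1 D2]) simp_all
  finally show ?thesis .
qed

lemma ex1_parks_rotate:
  assumes "w \<in> words n"
  shows "\<exists>!k. k \<le> n \<and> parks (map (\<lambda>x. (x + (Suc n - k)) mod Suc n) w)"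
proof -
  let ?S = "\<lambda>l. int (length (filter (\<lambda>x. x < l) w)) - int l"
  have "(k \<le> n \<and> parks (map (\<lambda>x. (x + (Suc n - k)) mod Suc n) w)) \<longleftrightarrow>
    (k \<le> n \<and> (\<forall>l. k < l \<and> l \<le> n \<longrightarrow> ?S k \<le> ?S l) \<and> (\<forall>l<k. ?S k < ?S l))" for k
    using parks_rotate_iff[OF assms, of k] by argo
  then show ?thesis using ex1_first_minimum[of n ?S] by presburger
qed

lemma bij_betw_map_words:
  assumes "bij_betw \<sigma> {..n} {..n}"
  shows "bij_betw (map \<sigma>) (words n) (words n)"
proof -
  have inj: "inj_on (map \<sigma>) (words n)"
  proof (rule inj_onI)
    fix v w assume vw: "v \<in> words n" "w \<in> words n" and eq: "map \<sigma> v = map \<sigma> w"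
    have "set v \<union> set w \<subseteq> {..n}" using vw by (simp add: words_def)
    then have "inj_on \<sigma> (set v \<union> set w)"
      by (rule inj_on_subset[OF bij_betw_imp_inj_on[OF assms]])
    then show "v = w" by (rule map_inj_on[OF eq])
  qed
  have sub: "map \<sigma> ` words n \<subseteq> words n"
  proof
    fix v assume "v \<in> map \<sigma> ` words n"
    then obtain w where w: "set w \<subseteq> {..n}" "length w = n" "v = map \<sigma> w"
      unfolding words_def by blast
    have "\<sigma> ` set w \<subseteq> {..n}" using w(1) bij_betw_imp_surj_on[OF assms] by blast
    then show "v \<in> words n" using w(2,3) by (simp add: words_def)
  qed
  show ?thesis
    unfolding bij_betw_def using inj endo_inj_surj[OF finite_words sub inj] by blast
qed

text \<open>A permutation of the letters only permutes the factors, because every letter carries the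
  same weight \<open>m\<close>.\<close>

lemma prod_count_list_map:
  assumes \<sigma>: "bij_betw \<sigma> A A" and "set w \<subseteq> A"
  shows "(\<Prod>i\<in>A. m (count_list (map \<sigma> w) i)) = (\<Prod>i\<in>A. m (count_list w i))"
proof -
  have "count_list (map \<sigma> w) (\<sigma> i) = count_list w i" if "i \<in> A" for i
    using assms(2) that \<sigma> by (induction w) (auto simp: bij_betw_def inj_on_def)
  then show ?thesis
    using prod.reindex_bij_betw[OF \<sigma>, of "\<lambda>i. m (count_list (map \<sigma> w) i)"] by simp
qed

text \<open>Double counting of pairs of a word and a rotation that makes it park. Each word has
  exactly one such rotation; for each of the \<open>n + 1\<close> rotations, reindexing by it leaves
  the sum over the words that park.\<close>

lemma sum_words_eq_sum_parks:
  fixes m :: "nat \<Rightarrow> 'k::comm_semiring_1"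
  defines "W \<equiv> \<lambda>n w. \<Prod>i\<le>n. m (count_list w i)"
  shows "(\<Sum>w\<in>words n. W n w) = of_nat (Suc n) * (\<Sum>w | w \<in> words n \<and> parks w. W n w)"
proof -
  let ?\<rho> = "\<lambda>k x. (x + (Suc n - k)) mod Suc n"
  have one: "(\<Sum>k\<le>n. if parks (map (?\<rho> k) w) then W n w else 0) = W n w" if w: "w \<in> words n" for w
  proof -
    obtain k where k: "k \<le> n" "\<And>l. l \<le> n \<Longrightarrow> parks (map (?\<rho> l) w) \<longleftrightarrow> l = k"
      using ex1_parks_rotate[OF w] by metis
    have "(\<Sum>l\<le>n. if parks (map (?\<rho> l) w) then W n w else 0) = (\<Sum>l\<le>n. if l = k then W n w else 0)"
      using k by (intro sum.cong) auto
    then show ?thesis using k(1) by simp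
  qed
  have shift: "(\<Sum>w\<in>words n. if parks (map (?\<rho> k) w) then W n w else 0)
      = (\<Sum>w\<in>words n. if parks w then W n w else 0)" if "k \<le> n" for k
  proof -
    have "(\<Sum>w\<in>words n. if parks (map (?\<rho> k) w) then W n w else 0)
        = (\<Sum>w\<in>words n. if parks (map (?\<rho> k) w) then W n (map (?\<rho> k) w) else 0)"
      unfolding W_def using rotation_bij[OF that]
      by (intro sum.cong refl if_cong prod_count_list_map[symmetric]) (auto simp: words_def)
    also have "\<dots> = (\<Sum>w\<in>words n. if parks w then W n w else 0)"
      by (rule sum.reindex_bij_betw[OF bij_betw_map_words[OF rotation_bij[OF that]],
            of "\<lambda>w. if parks w then W n w else 0"])
    finally show ?thesis .
  qed
  have "(\<Sum>w\<in>words n. W n w) = (\<Sum>w\<in>words n. \<Sum>k\<le>n. if parks (map (?\<rho> k) w) then W n w else 0)"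
    using one by simp
  also have "\<dots> = (\<Sum>k\<le>n. \<Sum>w\<in>words n. if parks (map (?\<rho> k) w) then W n w else 0)"
    by (rule sum.swap)
  also have "\<dots> = of_nat (Suc n) * (\<Sum>w\<in>words n. if parks w then W n w else 0)"
    using shift by (simp del: of_nat_Suc)
  also have "(\<Sum>w\<in>words n. if parks w then W n w else 0) = (\<Sum>w | w \<in> words n \<and> parks w. W n w)"
    using finite_words by (simp add: sum.inter_filter)
  finally show ?thesis .
qed

section \<open>Exponential generating functions of words\<close>

lemma fps_nth_0_prod: "prod f A $ 0 = (\<Prod>i\<in>A. f i $ 0)"
  by (induction A rule: infinite_finite_induct) simp_all

text \<open>The Leibniz rule, with the differentiated factor written as a function update to match
  the updated weights in \<open>sum_lists_prod_count\<close>.\<close>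

lemma fps_deriv_prod:
  fixes f :: "'i \<Rightarrow> 'a::comm_semiring_1 fps"
  assumes "finite A"
  shows "fps_deriv (prod f A) = (\<Sum>j\<in>A. prod (f(j := fps_deriv (f j))) A)"
  using assms
proof (induction A rule: finite_induct)
  case (insert x A)
  have 1: "prod (f(x := fps_deriv (f x))) A = prod f A"
    using insert.hyps by (intro prod.cong) auto
  have "(\<Sum>j\<in>A. prod (f(j := fps_deriv (f j))) (insert x A))
      = (\<Sum>j\<in>A. f x * prod (f(j := fps_deriv (f j))) A)"
    using insert.hyps by (intro sum.cong refl) auto
  also have "\<dots> = f x * fps_deriv (prod f A)"
    by (simp add: insert.IH sum_distrib_left)
  finally show ?case using insert.hyps 1 by (simp add: add.commute)
qed simp

definition egf :: "(nat \<Rightarrow> 'k::field) \<Rightarrow> 'k fps" where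
  "egf a = Abs_fps (\<lambda>k. a k / of_nat (fact k))"

lemma of_nat_neq_0_CHAR:
  assumes "CHAR('k::semiring_1) = 0" "n > 0"
  shows "of_nat n \<noteq> (0::'k)"
  using assms CHAR_eq0_iff by blast

lemma fps_deriv_egf:
  assumes "CHAR('k::field) = 0"
  shows "fps_deriv (egf a) = egf (\<lambda>k. a (Suc k) :: 'k)"
proof (rule fps_ext)
  fix n
  have "of_nat (Suc n) \<noteq> (0::'k)" by (rule of_nat_neq_0_CHAR[OF assms]) simp
  moreover have "of_nat (fact (Suc n)) = (of_nat (Suc n) * of_nat (fact n) :: 'k)"
    by (simp only: fact_Suc of_nat_mult of_nat_id)
  ultimately show "fps_deriv (egf a) $ n = egf (\<lambda>k. a (Suc k)) $ n"
    by (simp add: egf_def del: of_nat_Suc fact_Suc)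
qed

text \<open>Removing the first letter \<open>j\<close> of a word shifts the weights \<open>a j\<close>, which is
  differentiation of the \<open>j\<close>-th factor.\<close>

lemma sum_lists_prod_count:
  fixes a :: "'i \<Rightarrow> nat \<Rightarrow> 'k::field"
  assumes "CHAR('k) = 0" "finite I"
  shows "(\<Sum>w | set w \<subseteq> I \<and> length w = n. \<Prod>i\<in>I. a i (count_list w i)) =
    of_nat (fact n) * (\<Prod>i\<in>I. egf (a i)) $ n"
proof (induction n arbitrary: a)
  case 0
  have "{w. set w \<subseteq> I \<and> length w = 0} = {[]}" by auto
  then show ?case by (simp add: fps_nth_0_prod egf_def)
next
  case (Suc n)
  let ?L = "\<lambda>n. {w. set w \<subseteq> I \<and> length w = n}"
  let ?a = "\<lambda>j. a(j := \<lambda>k. a j (Suc k))"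
  have "(\<Sum>w\<in>?L (Suc n). \<Prod>i\<in>I. a i (count_list w i))
      = (\<Sum>(w, j)\<in>?L n \<times> I. \<Prod>i\<in>I. a i (count_list (j # w) i))"
    unfolding lists_length_Suc_eq
    by (subst sum.reindex[OF inj_split_Cons]) (simp add: case_prod_unfold)
  also have "\<dots> = (\<Sum>w\<in>?L n. \<Sum>j\<in>I. \<Prod>i\<in>I. a i (count_list (j # w) i))"
    by (rule sum.cartesian_product[symmetric])
  also have "\<dots> = (\<Sum>j\<in>I. \<Sum>w\<in>?L n. \<Prod>i\<in>I. a i (count_list (j # w) i))"
    by (rule sum.swap)
  also have "\<dots> = (\<Sum>j\<in>I. \<Sum>w\<in>?L n. \<Prod>i\<in>I. ?a j i (count_list w i))"
    by (intro sum.cong prod.cong refl) auto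
  also have "\<dots> = of_nat (fact n) * (\<Sum>j\<in>I. \<Prod>i\<in>I. egf (?a j i)) $ n"
    by (simp only: Suc.IH sum_distrib_left fps_sum_nth)
  also have "(\<Sum>j\<in>I. \<Prod>i\<in>I. egf (?a j i)) = fps_deriv (\<Prod>i\<in>I. egf (a i))"
    unfolding fps_deriv_prod[OF assms(2)]
    by (intro sum.cong prod.cong refl) (auto simp: fps_deriv_egf[OF assms(1)])
  \<comment> \<open>The coefficient of the derivative supplies the factor \<open>Suc n\<close> that
    completes the factorial.\<close>
  finally show ?case by (simp add: algebra_simps)
qed

text \<open>The value of \<open>n! V_n\<close> in terms of a moment sequence \<open>m\<close> alone,
  without umbrae.\<close>

lemma sum_park_prod_count:
  fixes m :: "nat \<Rightarrow> 'k::field"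
  assumes "CHAR('k) = 0" "m 0 = 1" "n \<ge> 1"
  shows "(\<Sum>p\<in>park n. \<Prod>i\<in>{1..n}. m (count_list p i)) =
    of_nat (fact (n - 1)) * (fps_deriv (egf m) * egf m ^ n) $ (n - 1)"
proof -
  let ?f = "egf m"
  have "(\<Sum>p\<in>park n. \<Prod>i\<in>{1..n}. m (count_list p i))
      = (\<Sum>w | w \<in> words n \<and> parks w. \<Prod>i\<in>{1..n}. m (count_list (map Suc w) i))"
    unfolding park_eq by (subst sum.reindex) (simp_all add: inj_on_def)
  also have "\<dots> = (\<Sum>w | w \<in> words n \<and> parks w. \<Prod>i\<le>n. m (count_list w i))"
  proof (rule sum.cong[OF refl])
    fix w assume "w \<in> {w. w \<in> words n \<and> parks w}"
    then have "map Suc w \<in> park n" by (auto simp: park_eq)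
    \<comment> \<open>The extra letter contributes only the factor \<open>m 0 = 1\<close>, so the
      product over \<open>n + 1\<close> letters shrinks to one over \<open>n\<close> umbrae.\<close>
    then have "n \<notin> set w" using set_park by fastforce
    then have "(\<Prod>i\<le>n. m (count_list w i)) = (\<Prod>i<n. m (count_list w i))"
      using assms(2) by (simp add: lessThan_Suc_atMost[symmetric])
    also have "\<dots> = (\<Prod>i\<in>{1..n}. m (count_list (map Suc w) i))"
      by (rule prod.reindex_bij_witness[of _ "\<lambda>i. i - 1" Suc])
        (auto simp: count_list_map_conv)
    finally show "(\<Prod>i\<in>{1..n}. m (count_list (map Suc w) i)) = (\<Prod>i\<le>n. m (count_list w i))" ..
  qed
  finally have park: "(\<Sum>p\<in>park n. \<Prod>i\<in>{1..n}. m (count_list p i))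
      = (\<Sum>w | w \<in> words n \<and> parks w. \<Prod>i\<le>n. m (count_list w i))" .
  obtain k where n: "n = Suc k" using assms(3) by (cases n) auto
  have "of_nat (Suc n) * (\<Sum>p\<in>park n. \<Prod>i\<in>{1..n}. m (count_list p i))
      = (\<Sum>w\<in>words n. \<Prod>i\<le>n. m (count_list w i))"
    unfolding park by (rule sum_words_eq_sum_parks[symmetric])
  also have "\<dots> = of_nat (fact n) * (?f ^ Suc n) $ n"
    unfolding words_def using sum_lists_prod_count[OF assms(1), of "{..n}" "\<lambda>_. m" n] by simp
  also have "\<dots> = of_nat (fact k) * fps_deriv (?f ^ Suc n) $ k"
    unfolding n fact_Suc of_nat_id of_nat_mult fps_deriv_nth
    by (simp only: Suc_eq_plus1 mult_ac)
  \<comment> \<open>The exponent produces the factor \<open>Suc n\<close> that cancels the number of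
    rotations on the left.\<close>
  also have "fps_deriv (?f ^ Suc n) = fps_const (of_nat (Suc n)) * (fps_deriv ?f * ?f ^ n)"
    by (simp only: fps_deriv_power diff_Suc_1 mult.assoc)
  also have "of_nat (fact k) * \<dots> $ k
      = of_nat (Suc n) * (of_nat (fact k) * (fps_deriv ?f * ?f ^ n) $ k)"
    unfolding fps_mult_left_const_nth by (rule mult.left_commute)
  finally show ?thesis
    using of_nat_neq_0_CHAR[OF assms(1), of "Suc n"] n by (simp del: of_nat_Suc)
qed

section \<open>Monomials and the passage to the fraction field\<close>

text \<open>Collecting equal factors gives the form to which \<open>E_uncorrelated\<close>
  applies.\<close>

lemma prod_list_map_eq_prod_count:
  fixes y :: "'i \<Rightarrow> 'b::comm_monoid_mult"
  assumes "set p \<subseteq> A" "finite A"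
  shows "prod_list (map y p) = (\<Prod>i\<in>A. y i ^ count_list p i)"
  using assms(1)
proof (induction p)
  case (Cons x p)
  have "(\<Prod>i\<in>A. y i ^ count_list (x # p) i)
      = (\<Prod>i\<in>A. (if i = x then y i else 1) * y i ^ count_list p i)"
    by (intro prod.cong) auto
  also have "\<dots> = y x * prod_list (map y p)"
    using Cons assms(2) by (simp add: prod.distrib)
  finally show ?case by simp
qed simp

lemma to_fract_of_nat [simp]: "to_fract (of_nat k) = of_nat k"
  by (induction k) simp_all

lemma to_fract_prod: "to_fract (prod f A) = (\<Prod>i\<in>A. to_fract (f i))"
  by (induction A rule: infinite_finite_induct) simp_all

lemma embed_mvpoly_add: "embed_mvpoly (p + q) = embed_mvpoly p + embed_mvpoly q"
  unfolding embed_mvpoly_def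
  by (rule poly_mapping_eqI) (simp add: Poly_Mapping.map.rep_eq lookup_add when_def flip: to_fract_add)

lemma embed_mvpoly_0: "embed_mvpoly 0 = 0"
  unfolding embed_mvpoly_def by (rule poly_mapping_eqI) (simp add: Poly_Mapping.map.rep_eq)

lemma embed_mvpoly_sum: "embed_mvpoly (sum f A) = (\<Sum>x\<in>A. embed_mvpoly (f x))"
  by (induction A rule: infinite_finite_induct) (simp_all add: embed_mvpoly_add embed_mvpoly_0)

text \<open>Being one monomial with coefficient 1, such a product is carried by
  \<open>embed_mvpoly\<close> to its namesake over the fraction field.\<close>

lemma prod_list_Var:
  "prod_list (map (\<lambda>i. Var (v i)) p)
    = Poly_Mapping.single (\<Sum>i\<leftarrow>p. Poly_Mapping.single (v i) 1) 1"
  by (induction p) (simp_all add: Var_def mult_single)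

lemma embed_mvpoly_prod_list_Var:
  "embed_mvpoly (prod_list (map (\<lambda>i. Var (v i)) p)) = prod_list (map (\<lambda>i. Var (v i)) p)"
  by (simp add: prod_list_Var embed_mvpoly_def)

text \<open>With umbrae for \<open>y\<close>, the right side has coefficients in the image of the
  base ring, so it has a preimage under \<open>embed_mvpoly\<close> on which \<open>E\<close> is
  defined.\<close>

lemma fact_volume_poly:
  fixes y :: "nat \<Rightarrow> ('v, 'k::field) mvpoly"
  assumes "CHAR('k) = 0"
  shows "of_nat (fact n) * volume_poly n y = (\<Sum>p\<in>park n. prod_list (map y p))"
proof -
  have "of_nat (fact n) \<noteq> (0::'k)" by (rule of_nat_neq_0_CHAR[OF assms]) simp
  moreover have "(of_nat (fact n) :: ('v, 'k) mvpoly) = Poly_Mapping.single 0 (of_nat (fact n))"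
    by (simp only: single_of_nat)
  ultimately have "of_nat (fact n) * Const (1 / of_nat (fact n)) = (1 :: ('v, 'k) mvpoly)"
    by (simp only: Const_def mult_single) simp
  then show ?thesis by (simp only: volume_poly_def mult.assoc[symmetric] mult_1_left)
qed

section \<open>Evaluation of umbral polynomials\<close>

lemma gen_fun_eq_egf: "gen_fun E \<alpha> = egf (\<lambda>k. to_fract (E (Var \<alpha> ^ k)))"
  by (simp add: gen_fun_def egf_def)

context umbral_calculus
begin

lemma E_0: "E 0 = 0"
  using E_scale[of 0 0] by simp

lemma E_sum: "E (sum f A) = (\<Sum>x\<in>A. E (f x))"
  by (induction A rule: infinite_finite_induct) (simp_all add: E_0 E_add)

lemma E_of_nat_mult: "E (of_nat k * p) = of_nat k * E p"
  using E_scale[of "of_nat k" p] by (simp add: Const_def)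

lemma E_prod_Var_inj:
  assumes "finite A" "inj_on v A"
  shows "E (\<Prod>i\<in>A. Var (v i) ^ e i) = (\<Prod>i\<in>A. E (Var (v i) ^ e i))"
proof -
  have "E (\<Prod>\<alpha>\<in>v ` A. Var \<alpha> ^ (e (inv_into A v \<alpha>)))
      = (\<Prod>\<alpha>\<in>v ` A. E (Var \<alpha> ^ (e (inv_into A v \<alpha>))))"
    using assms(1) by (intro E_uncorrelated) simp
  then show ?thesis
    using assms(2) by (simp add: prod.reindex)
qed

lemma E_mult_Var_power:
  assumes "\<alpha> \<noteq> \<beta>"
  shows "E (Var \<alpha> ^ i * Var \<beta> ^ j) = E (Var \<alpha> ^ i) * E (Var \<beta> ^ j)"
  using E_uncorrelated[of "{\<alpha>, \<beta>}" "(\<lambda>_. j)(\<alpha> := i)"] assms by simp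

text \<open>The extra factor \<open>Var \<alpha>\<close> raises every moment index of \<alpha> by
  one, which differentiates its generating function; the binomial convolution of moments is then a
  product of series.\<close>

lemma E_mult_power_add:
  assumes "CHAR('r fract) = 0" "\<alpha> \<noteq> \<beta>"
  shows "to_fract (E (Var \<alpha> * (Var \<alpha> + Var \<beta>) ^ m)) =
    of_nat (fact m) * (fps_deriv (gen_fun E \<alpha>) * gen_fun E \<beta>) $ m"
proof -
  let ?a = "\<lambda>i. to_fract (E (Var \<alpha> ^ i))" and ?b = "\<lambda>i. to_fract (E (Var \<beta> ^ i))"
  have "Var \<alpha> * (Var \<alpha> + Var \<beta>) ^ m
      = (\<Sum>i\<le>m. of_nat (m choose i) * (Var \<alpha> ^ Suc i * Var \<beta> ^ (m - i)) :: ('a, 'r) umbral_poly)"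
    unfolding binomial_ring sum_distrib_left by (intro sum.cong refl) (simp add: mult_ac)
  then have "to_fract (E (Var \<alpha> * (Var \<alpha> + Var \<beta>) ^ m))
      = (\<Sum>i\<le>m. of_nat (m choose i) * (?a (Suc i) * ?b (m - i)))"
    by (simp only: E_sum E_of_nat_mult E_mult_Var_power[OF assms(2)]
        to_fract_sum to_fract_mult to_fract_of_nat)
  also have "\<dots> = (\<Sum>i\<le>m. of_nat (fact m) *
      (?a (Suc i) / of_nat (fact i) * (?b (m - i) / of_nat (fact (m - i)))))"
  proof (rule sum.cong[OF refl])
    fix i assume "i \<in> {..m}"
    then have "of_nat (fact i * fact (m - i) * (m choose i)) = (of_nat (fact m) :: 'r fract)"
      by (simp only: binomial_fact_lemma atMost_iff)
    then have "of_nat (fact m) = of_nat (fact i) * of_nat (fact (m - i)) * (of_nat (m choose i) :: 'r fract)"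
      by (simp only: of_nat_mult)
    moreover have "of_nat (fact l) \<noteq> (0 :: 'r fract)" for l
      by (rule of_nat_neq_0_CHAR[OF assms(1)]) simp
    ultimately show "of_nat (m choose i) * (?a (Suc i) * ?b (m - i)) = of_nat (fact m) *
        (?a (Suc i) / of_nat (fact i) * (?b (m - i) / of_nat (fact (m - i))))"
      by (simp add: field_simps del: of_nat_mult)
  qed
  also have "\<dots> = of_nat (fact m) * (fps_deriv (gen_fun E \<alpha>) * gen_fun E \<beta>) $ m"
    unfolding gen_fun_eq_egf fps_deriv_egf[OF assms(1)]
    by (simp add: fps_mult_nth egf_def sum_distrib_left atLeast0AtMost)
  finally show ?thesis .
qed

lemma gen_fun_nth_0: "gen_fun E \<alpha> $ 0 = 1"
  by (simp add: gen_fun_def E_one)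

text \<open>The constant term 1 makes the generating function invertible, so the two inversions
  cancel.\<close>

lemma gen_fun_Dot_neg_neg:
  "gen_fun E (Dot (- int n) (Dot (- 1) \<alpha>)) = gen_fun E \<alpha> ^ n"
  by (simp add: gen_fun_Dot power_int_def gen_fun_nth_0)

end

theorem theorem3p1:
  fixes E :: "('a, 'r::idom) umbral_poly \<Rightarrow> 'r"
    and \<alpha> :: "'a umbra"
    and \<alpha>s :: "nat \<Rightarrow> 'a umbra"
    and n :: nat
  assumes "CHAR('r fract) = 0"
    and "umbral_calculus E"
    and "n \<ge> 1"
    and "inj_on \<alpha>s {1..n}"
    and "\<And>i. i \<in> {1..n} \<Longrightarrow> similar E (Var (\<alpha>s i)) (Var \<alpha>)"
  shows "\<exists>P :: ('a, 'r) umbral_poly.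
      embed_mvpoly P = of_nat (fact n) * volume_poly n (\<lambda>i. Var (\<alpha>s i)) \<and>
      umbral_equiv E P (abel_poly n (Var \<alpha>) (Dot (-1) \<alpha>)) \<and>
      umbral_equiv E (abel_poly n (Var \<alpha>) (Dot (-1) \<alpha>))
        (Var \<alpha> * (Var \<alpha> + Var (Dot (int n) \<alpha>)) ^ (n - 1))"
proof -
  interpret umbral_calculus E by fact
  \<comment> \<open>The witness is \<open>n! V_n\<close> over \<open>'r\<close> itself, before any
    division by \<open>n!\<close>.\<close>
  let ?P = "\<Sum>p\<in>park n. prod_list (map (\<lambda>i. Var (\<alpha>s i)) p) :: ('a, 'r) umbral_poly"
  let ?m = "\<lambda>k. E (Var \<alpha> ^ k)"
  \<comment> \<open>The common value of all three evaluations, in the fraction field; injectivity of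
    \<open>to_fract\<close> brings the equalities back to \<open>'r\<close>.\<close>
  let ?c = "of_nat (fact (n - 1)) * (fps_deriv (gen_fun E \<alpha>) * gen_fun E \<alpha> ^ n) $ (n - 1)"
  have E_monom: "E (prod_list (map (\<lambda>i. Var (\<alpha>s i)) p)) = (\<Prod>i\<in>{1..n}. ?m (count_list p i))"
    if "p \<in> park n" for p
  proof -
    have "E (prod_list (map (\<lambda>i. Var (\<alpha>s i)) p))
        = E (\<Prod>i\<in>{1..n}. Var (\<alpha>s i) ^ count_list p i)"
      using set_park[OF that] by (subst prod_list_map_eq_prod_count[of p "{1..n}"]) simp_all
    also have "\<dots> = (\<Prod>i\<in>{1..n}. E (Var (\<alpha>s i) ^ count_list p i))"
      by (rule E_prod_Var_inj) (use assms(4) in simp_all)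
    also have "\<dots> = (\<Prod>i\<in>{1..n}. ?m (count_list p i))"
      by (intro prod.cong refl) (use assms(5) in \<open>simp add: similar_def\<close>)
    finally show ?thesis .
  qed
  have "to_fract (E ?P) = (\<Sum>p\<in>park n. \<Prod>i\<in>{1..n}. to_fract (?m (count_list p i)))"
    by (simp add: E_sum E_monom to_fract_prod)
  also have "\<dots> = ?c"
    unfolding gen_fun_eq_egf
    by (rule sum_park_prod_count[OF assms(1) _ assms(3)]) (simp add: E_one)
  finally have vol: "to_fract (E ?P) = ?c" .
  \<comment> \<open>Each \<open>Dot\<close> increases the size of the term, so the auxiliary umbrae
    are new symbols and uncorrelated with \<alpha>.\<close>
  have "Dot (- int n) (Dot (- 1) \<alpha>) \<noteq> \<alpha>" "Dot (int n) \<alpha> \<noteq> \<alpha>"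
    by (auto dest: arg_cong[where f = size])
  note distinct = this[symmetric]
  have abel: "to_fract (E (abel_poly n (Var \<alpha>) (Dot (- 1) \<alpha>))) = ?c"
    unfolding abel_poly_def E_mult_power_add[OF assms(1) distinct(1)] gen_fun_Dot_neg_neg ..
  have dot: "to_fract (E (Var \<alpha> * (Var \<alpha> + Var (Dot (int n) \<alpha>)) ^ (n - 1))) = ?c"
    unfolding E_mult_power_add[OF assms(1) distinct(2)] gen_fun_Dot by simp
  have "embed_mvpoly ?P = of_nat (fact n) * volume_poly n (\<lambda>i. Var (\<alpha>s i))"
    by (simp only: fact_volume_poly[OF assms(1)] embed_mvpoly_sum embed_mvpoly_prod_list_Var)
  moreover have "E ?P = E (abel_poly n (Var \<alpha>) (Dot (- 1) \<alpha>))"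
    using vol abel by (metis to_fract_eq_iff)
  moreover have "E (abel_poly n (Var \<alpha>) (Dot (- 1) \<alpha>))
      = E (Var \<alpha> * (Var \<alpha> + Var (Dot (int n) \<alpha>)) ^ (n - 1))"
    using abel dot by (metis to_fract_eq_iff)
  ultimately show ?thesis unfolding umbral_equiv_def by blast
qed

end
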